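(* Let $n \ge 2$ and let $Q_{4n} = \langle x, y \mid x^2 = y^n,\ y^{2n} = 1,\ yx = xy^{-1}\rangle$ be the dicyclic group of order $4n$. Let $S$ be a sequence of $2n$ elements of $Q_{4n}$. \begin{enumerate} \item If $n \ge 3$, then the following are equivalent: (i) $S$ is free of product-$1$ subsequences; (ii) there exist integers $t$ with $1 \le t \le 2n-1$ and $\gcd(t,2n)=1$, and $s$ with $0 \le s \le 2n-1$, such that $S = (y^t, y^t, \dots, y^t, xy^s)$, where $y^t$ appears exactly $2n-1$ times. \item If $n = 2$, then $S$ is free of product-$1$ subsequences if and only if there exist $r \in \mathbb{Z}_4^*$ (i.e. $r \in \{1,3\}$) and $s \in \mathbb{Z}_4$ such that $S$ is one of $$(y^r, y^r, y^r, xy^s),\quad (y^r, xy^s, xy^s, xy^s),\quad (xy^s, xy^s, xy^s, xy^{r+s}).$$ \end{enumerate}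
   Context: A sequence in a finite group $G$ is a finite list $(g_1,\dots,g_l)$ of elements of $G$ with repetitions allowed; sequences are considered up to reordering of their terms. A subsequence is obtained by choosing a subset of the index set $\{1,\dots,l\}$. A non-empty subsequence $(g_{n_1},\dots,g_{n_k})$ is a product-$1$ subsequence if $g_{\sigma(n_1)} g_{\sigma(n_2)} \cdots g_{\sigma(n_k)} = 1$ for some permutation $\sigma$ of $\{n_1,\dots,n_k\}$. A sequence is free of product-$1$ subsequences if it has no non-empty product-$1$ subsequence. *)

theory Defs
  imports "HOL-Library.Multiset" "HOL-Combinatorics.Permutations" "HOL-Algebra.Group"
    "HOL-Algebra.Coset"
begin

text \<open>A letter \<open>(a, True)\<close> stands for the generator \<open>a\<close> and \<open>(a, False)\<close> for its inverse.
  A pair \<open>(u, v)\<close> of words in \<open>R\<close> is the relation \<open>u = v\<close>. The generators are all elements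
  of the type \<open>'a\<close>.\<close>

type_synonym 'a word = "('a \<times> bool) list"

inductive pres_eq :: "('a word \<times> 'a word) set \<Rightarrow> 'a word \<Rightarrow> 'a word \<Rightarrow> bool"
  for R :: "('a word \<times> 'a word) set" where
  pres_rel: "(u, v) \<in> R \<Longrightarrow> pres_eq R u v"
| pres_cancel: "pres_eq R [(a, b), (a, \<not> b)] []"
| pres_refl: "pres_eq R u u"
| pres_sym: "pres_eq R u v \<Longrightarrow> pres_eq R v u"
| pres_trans: "pres_eq R u v \<Longrightarrow> pres_eq R v w \<Longrightarrow> pres_eq R u w"
| pres_append: "pres_eq R u u' \<Longrightarrow> pres_eq R v v' \<Longrightarrow> pres_eq R (u @ v) (u' @ v')"

definition pres_class :: "('a word \<times> 'a word) set \<Rightarrow> 'a word \<Rightarrow> 'a word set" where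
  "pres_class R u = {v. pres_eq R u v}"

definition presented_group :: "('a word \<times> 'a word) set \<Rightarrow> 'a word set monoid" where
  "presented_group R =
     \<lparr>carrier = range (pres_class R),
      mult = (\<lambda>A B. \<Union>u\<in>A. \<Union>v\<in>B. pres_class R (u @ v)),
      one = pres_class R []\<rparr>"

lemma pres_class_eq_iff: "pres_class R u = pres_class R v \<longleftrightarrow> pres_eq R u v"
  unfolding pres_class_def by (blast intro: pres_refl pres_sym pres_trans)

lemma presented_group_mult:
  "pres_class R u \<otimes>\<^bsub>presented_group R\<^esub> pres_class R v = pres_class R (u @ v)"
proof -
  have "pres_class R (u' @ v') = pres_class R (u @ v)"
    if "u' \<in> pres_class R u" "v' \<in> pres_class R v" for u' v'
    using that by (simp add: pres_class_eq_iff)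
      (auto simp: pres_class_def intro: pres_sym pres_append)
  then have "(\<Union>u'\<in>pres_class R u. \<Union>v'\<in>pres_class R v. pres_class R (u' @ v'))
      = (\<Union>u'\<in>pres_class R u. \<Union>v'\<in>pres_class R v. pres_class R (u @ v))"
    by (intro SUP_cong refl)
  also have "\<dots> = pres_class R (u @ v)"
    by (auto simp: pres_class_def intro: pres_refl)
  finally show ?thesis
    unfolding presented_group_def by simp
qed

lemma pres_inverse: "\<exists>v. pres_eq R (v @ u) []"
proof (induction u)
  case Nil
  show ?case using pres_refl by force
next
  case (Cons l u)
  obtain a b where l: "l = (a, b)" by (cases l)
  from Cons obtain v where v: "pres_eq R (v @ u) []" by blast
  have "pres_eq R [(a, \<not> b), (a, \<not> \<not> b)] []" by (rule pres_cancel)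
  then have "pres_eq R (v @ ([(a, \<not> b), (a, b)] @ u)) (v @ ([] @ u))"
    by (intro pres_append pres_refl) simp
  with v have "pres_eq R ((v @ [(a, \<not> b)]) @ (l # u)) []"
    using l pres_trans by fastforce
  then show ?case by blast
qed

lemma group_presented_group: "group (presented_group R)"
proof (rule groupI)
  fix A assume "A \<in> carrier (presented_group R)"
  then obtain u where u: "A = pres_class R u" by (auto simp: presented_group_def)
  obtain v where "pres_eq R (v @ u) []" using pres_inverse by blast
  then have "pres_class R v \<otimes>\<^bsub>presented_group R\<^esub> A = \<one>\<^bsub>presented_group R\<^esub>"
    unfolding u presented_group_mult by (simp add: presented_group_def pres_class_eq_iff)
  then show "\<exists>B\<in>carrier (presented_group R). B \<otimes>\<^bsub>presented_group R\<^esub> A = \<one>\<^bsub>presented_group R\<^esub>"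
    by (auto simp: presented_group_def)
next
  fix A B C
  assume "A \<in> carrier (presented_group R)" "B \<in> carrier (presented_group R)"
    "C \<in> carrier (presented_group R)"
  then obtain u v w where "A = pres_class R u" "B = pres_class R v" "C = pres_class R w"
    by (auto simp: presented_group_def)
  then show "A \<otimes>\<^bsub>presented_group R\<^esub> B \<otimes>\<^bsub>presented_group R\<^esub> C =
      A \<otimes>\<^bsub>presented_group R\<^esub> (B \<otimes>\<^bsub>presented_group R\<^esub> C)"
    by (simp add: presented_group_mult)
next
  fix A B
  assume "A \<in> carrier (presented_group R)" "B \<in> carrier (presented_group R)"
  then obtain u v where "A = pres_class R u" "B = pres_class R v"
    by (auto simp: presented_group_def)
  then show "A \<otimes>\<^bsub>presented_group R\<^esub> B \<in> carrier (presented_group R)"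
    by (simp add: presented_group_mult) (simp add: presented_group_def)
next
  show "\<one>\<^bsub>presented_group R\<^esub> \<in> carrier (presented_group R)"
    by (simp add: presented_group_def)
next
  fix A assume "A \<in> carrier (presented_group R)"
  then obtain u where "A = pres_class R u" by (auto simp: presented_group_def)
  moreover have "\<one>\<^bsub>presented_group R\<^esub> = pres_class R []" by (simp add: presented_group_def)
  ultimately show "\<one>\<^bsub>presented_group R\<^esub> \<otimes>\<^bsub>presented_group R\<^esub> A = A"
    by (simp add: presented_group_mult)
qed

datatype dicyclic_gen = GenX | GenY

definition dicyclic_relations :: "nat \<Rightarrow> (dicyclic_gen word \<times> dicyclic_gen word) set" where
  "dicyclic_relations n =
     {(replicate 2 (GenX, True), replicate n (GenY, True)),
      (replicate (2 * n) (GenY, True), []),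
      ([(GenY, True), (GenX, True)], [(GenX, True), (GenY, False)])}"

definition dicyclic :: "nat \<Rightarrow> dicyclic_gen word set monoid" where
  "dicyclic n = presented_group (dicyclic_relations n)"

definition dic_x :: "nat \<Rightarrow> dicyclic_gen word set" where
  "dic_x n = pres_class (dicyclic_relations n) [(GenX, True)]"

definition dic_y :: "nat \<Rightarrow> dicyclic_gen word set" where
  "dic_y n = pres_class (dicyclic_relations n) [(GenY, True)]"

lemma group_dicyclic: "group (dicyclic n)"
  unfolding dicyclic_def by (rule group_presented_group)

lemma dicyclic_normal_form:
  assumes "n \<ge> 1"
  shows "\<exists>e<2. \<exists>k<2 * n. pres_eq (dicyclic_relations n) w
           (replicate e (GenX, True) @ replicate k (GenY, True))"
proof -
  let ?R = "dicyclic_relations n"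
  let ?x = "(GenX, True)" and ?y = "(GenY, True)"
  define P where "P w = (\<exists>e<2. \<exists>k. pres_eq ?R w (replicate e ?x @ replicate k ?y))" for w
  have PI: "P w" if "pres_eq ?R w (replicate e ?x @ replicate k ?y)" "e < 2" for w e k
    using that unfolding P_def by blast
  have Pcong: "P v" if "P u" "pres_eq ?R v u" for u v
    using that unfolding P_def by (meson pres_trans)
  have xx: "pres_eq ?R [?x, ?x] (replicate n ?y)"
    by (rule pres_rel) (simp add: dicyclic_relations_def numeral_2_eq_2)
  have y2n: "pres_eq ?R (replicate (2 * n) ?y) []"
    by (rule pres_rel) (simp add: dicyclic_relations_def)
  have yx: "pres_eq ?R [?y, ?x] [?x, (GenY, False)]"
    by (rule pres_rel) (simp add: dicyclic_relations_def)
  have "pres_eq ?R ([(GenY, False), (GenY, \<not> False)] @ replicate (2 * n - 1) ?y)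
      ([] @ replicate (2 * n - 1) ?y)"
    by (intro pres_append pres_cancel pres_refl)
  then have "pres_eq ?R ([(GenY, False)] @ replicate (2 * n) ?y) (replicate (2 * n - 1) ?y)"
    using assms by (cases n) simp_all
  moreover have "pres_eq ?R ([(GenY, False)] @ replicate (2 * n) ?y) ([(GenY, False)] @ [])"
    by (intro pres_append y2n pres_refl)
  ultimately have yinv: "pres_eq ?R [(GenY, False)] (replicate (2 * n - 1) ?y)"
    by (metis append_Nil2 pres_sym pres_trans)
  have "pres_eq ?R ([(GenX, False), (GenX, \<not> False)] @ (?x # replicate n ?y))
      ([] @ (?x # replicate n ?y))"
    by (intro pres_append pres_cancel pres_refl)
  moreover have "pres_eq ?R ([(GenX, False)] @ ([?x, ?x] @ replicate n ?y))
      ([(GenX, False)] @ (replicate n ?y @ replicate n ?y))"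
    by (intro pres_append xx pres_refl)
  moreover have "pres_eq ?R ([(GenX, False)] @ (replicate n ?y @ replicate n ?y))
      ([(GenX, False)] @ [])"
    using y2n by (intro pres_append pres_refl) (simp add: mult_2 replicate_add)
  ultimately have xinv: "pres_eq ?R [(GenX, False)] (?x # replicate n ?y)"
    by simp (meson pres_sym pres_trans)
  have Py: "P (?y # w)" if "P w" for w
  proof -
    from that obtain e k where e: "e < 2" and w: "pres_eq ?R w (replicate e ?x @ replicate k ?y)"
      unfolding P_def by blast
    have step: "pres_eq ?R (?y # w) ([?y] @ (replicate e ?x @ replicate k ?y))"
      using pres_append[OF pres_refl w, of "[?y]"] by simp
    show ?thesis
    proof (cases "e = 0")
      case True
      with step have "pres_eq ?R (?y # w) (replicate 0 ?x @ replicate (Suc k) ?y)" by simp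
      then show ?thesis by (rule PI) simp
    next
      case False
      with e have e1: "e = 1" by simp
      have "pres_eq ?R ([?y, ?x] @ replicate k ?y) ([?x, (GenY, False)] @ replicate k ?y)"
        by (intro pres_append yx pres_refl)
      moreover have "pres_eq ?R ([?x] @ ([(GenY, False)] @ replicate k ?y))
          ([?x] @ (replicate (2 * n - 1) ?y @ replicate k ?y))"
        by (intro pres_append yinv pres_refl)
      ultimately have "pres_eq ?R (?y # w) (replicate 1 ?x @ replicate (2 * n - 1 + k) ?y)"
        using step e1 by (simp add: replicate_add) (meson pres_trans)
      then show ?thesis by (rule PI) simp
    qed
  qed
  have Px: "P (?x # w)" if "P w" for w
  proof -
    from that obtain e k where e: "e < 2" and w: "pres_eq ?R w (replicate e ?x @ replicate k ?y)"
      unfolding P_def by blast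
    have step: "pres_eq ?R (?x # w) ([?x] @ (replicate e ?x @ replicate k ?y))"
      using pres_append[OF pres_refl w, of "[?x]"] by simp
    show ?thesis
    proof (cases "e = 0")
      case True
      with step have "pres_eq ?R (?x # w) (replicate 1 ?x @ replicate k ?y)" by simp
      then show ?thesis by (rule PI) simp
    next
      case False
      with e have e1: "e = 1" by simp
      have "pres_eq ?R ([?x, ?x] @ replicate k ?y) (replicate n ?y @ replicate k ?y)"
        by (intro pres_append xx pres_refl)
      then have "pres_eq ?R (?x # w) (replicate 0 ?x @ replicate (n + k) ?y)"
        using step e1 by (simp add: replicate_add) (meson pres_trans)
      then show ?thesis by (rule PI) simp
    qed
  qed
  have Pys: "P (replicate k ?y @ w)" if "P w" for k w
    using that by (induction k) (simp_all add: Py)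
  have Pw: "P w" for w
  proof (induction w)
    case Nil
    have "pres_eq ?R [] (replicate 0 ?x @ replicate 0 ?y)" using pres_refl by simp
    then show ?case by (rule PI) simp
  next
    case (Cons l w)
    consider "l = ?x" | "l = ?y" | "l = (GenX, False)" | "l = (GenY, False)"
      by (metis (full_types) dicyclic_gen.exhaust surj_pair)
    then show ?case
    proof cases
      case 3
      have "pres_eq ?R ([(GenX, False)] @ w) ((?x # replicate n ?y) @ w)"
        by (intro pres_append xinv pres_refl)
      with 3 Px[OF Pys[OF Cons]] show ?thesis by (auto intro: Pcong)
    next
      case 4
      have "pres_eq ?R ([(GenY, False)] @ w) (replicate (2 * n - 1) ?y @ w)"
        by (intro pres_append yinv pres_refl)
      with 4 Pys[OF Cons] show ?thesis by (auto intro: Pcong)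
    qed (simp_all add: Px Py Cons)
  qed
  have red: "pres_eq ?R (replicate k ?y) (replicate (k mod (2 * n)) ?y)" for k
  proof (induction k rule: less_induct)
    case (less k)
    show ?case
    proof (cases "k < 2 * n")
      case True
      then show ?thesis by (simp add: pres_refl)
    next
      case False
      then have "replicate k ?y = replicate (2 * n) ?y @ replicate (k - 2 * n) ?y"
        by (simp flip: replicate_add)
      moreover have "pres_eq ?R (replicate (2 * n) ?y @ replicate (k - 2 * n) ?y)
          ([] @ replicate (k - 2 * n) ?y)"
        by (intro pres_append y2n pres_refl)
      moreover have "pres_eq ?R (replicate (k - 2 * n) ?y) (replicate ((k - 2 * n) mod (2 * n)) ?y)"
        using False assms by (intro less) auto
      moreover have "(k - 2 * n) mod (2 * n) = k mod (2 * n)"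
        using False by (simp add: le_mod_geq)
      ultimately show ?thesis by (metis append_Nil pres_trans)
    qed
  qed
  from Pw[of w] obtain e k where e: "e < 2"
    and w: "pres_eq ?R w (replicate e ?x @ replicate k ?y)"
    unfolding P_def by blast
  have "pres_eq ?R w (replicate e ?x @ replicate (k mod (2 * n)) ?y)"
    using w pres_append[OF pres_refl red] by (rule pres_trans)
  moreover have "k mod (2 * n) < 2 * n" using assms by simp
  ultimately show ?thesis using e by blast
qed

text \<open>The left translation action of the letters on the normal forms \<open>x\<^sup>e y\<^sup>k\<close>, encoded
  as pairs \<open>(e = 1, k)\<close>, separates them.\<close>

fun dic_act_letter :: "nat \<Rightarrow> dicyclic_gen \<times> bool \<Rightarrow> bool \<times> int \<Rightarrow> bool \<times> int" where
  "dic_act_letter n (GenX, b) (e, k) =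
     (\<not> e, (if e = b then k + int n else k) mod (2 * int n))"
| "dic_act_letter n (GenY, b) (e, k) =
     (e, (if e = b then k - 1 else k + 1) mod (2 * int n))"

lemma dic_act_foldr_range:
  assumes "n \<ge> 1" "snd p \<in> {0..<2 * int n}"
  shows "snd (foldr (dic_act_letter n) w p) \<in> {0..<2 * int n}"
proof (induction w)
  case (Cons l w)
  obtain g b where l: "l = (g, b)" by (cases l)
  show ?case using assms(1) unfolding l
    by (cases g; cases "foldr (dic_act_letter n) w p") auto
qed (use assms in simp)

lemma dic_act_replicate_y:
  assumes "k \<in> {0..<2 * int n}"
  shows "(dic_act_letter n (GenY, True) ^^ m) (e, k) =
    (e, (if e then k - int m else k + int m) mod (2 * int n))"
proof (induction m)
  case (Suc m)
  then show ?case by (auto simp: mod_simps algebra_simps)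
qed (use assms in simp)

lemma dic_act_pres_eq:
  assumes "n \<ge> 1" "pres_eq (dicyclic_relations n) u v" "snd p \<in> {0..<2 * int n}"
  shows "foldr (dic_act_letter n) u p = foldr (dic_act_letter n) v p"
  using assms(2,3)
proof (induction arbitrary: p)
  case (pres_rel u v)
  obtain e k where p: "p = (e, k)" by (cases p)
  with pres_rel have k: "k \<in> {0..<2 * int n}" by simp
  have kn: "k mod (2 * int n) = k" using k by simp
  have ycase: "(dic_act_letter n (GenY, True) ^^ n) (e, k)
      = (e, (k + int n) mod (2 * int n))"
  proof -
    have "(k - int n) mod (2 * int n) = (k + int n) mod (2 * int n)"
      by (simp add: mod_eq_dvd_iff)
    then show ?thesis using k by (simp add: dic_act_replicate_y)
  qed
  show ?case using pres_rel(1) k kn ycase unfolding p dicyclic_relations_def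
    by (auto simp: numeral_2_eq_2 mod_simps dic_act_replicate_y simp del: replicate.simps(2))
      (auto simp: mod_simps algebra_simps)
next
  case (pres_cancel a b)
  then show ?case
    by (cases a; cases b; cases p) (auto simp: mod_simps)
next
  case (pres_append u u' v v')
  then show ?case using dic_act_foldr_range[OF assms(1)] by simp
qed auto

lemma order_dicyclic:
  assumes "n \<ge> 1"
  shows "order (dicyclic n) = 4 * n"
proof -
  let ?R = "dicyclic_relations n"
  define f where "f = (\<lambda>(e, k). pres_class ?R
    (replicate e (GenX, True) @ replicate k (GenY, True)))"
  have "inj_on f ({..<2} \<times> {..<2 * n})"
  proof (rule inj_onI, clarify)
    fix e k e' k'
    assume e: "e < (2::nat)" "e' < 2" and k: "k < 2 * n" "k' < 2 * n"
      and eq: "f (e, k) = f (e', k')"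
    have act: "foldr (dic_act_letter n) (replicate e (GenX, True) @ replicate k (GenY, True))
        (False, 0) = (e = 1, int k)" if "e < 2" "k < 2 * n" for e k
      using that by (cases "e = 0") (auto simp: dic_act_replicate_y less_2_cases_iff)
    from eq have "pres_eq ?R (replicate e (GenX, True) @ replicate k (GenY, True))
        (replicate e' (GenX, True) @ replicate k' (GenY, True))"
      by (simp add: f_def pres_class_eq_iff)
    from dic_act_pres_eq[OF assms this, of "(False, 0)"]
    have "(e = 1, int k) = (e' = 1, int k')"
      using act[OF e(1) k(1)] act[OF e(2) k(2)] assms by (simp del: foldr_append)
    with e show "e = e' \<and> k = k'" by auto
  qed
  moreover have "f ` ({..<2} \<times> {..<2 * n}) = carrier (dicyclic n)"
  proof -
    have "pres_class ?R w \<in> f ` ({..<2} \<times> {..<2 * n})" for w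
    proof -
      from dicyclic_normal_form[OF assms, of w] obtain e k where "e < 2" "k < 2 * n"
        "pres_class ?R w = f (e, k)"
        unfolding f_def by (auto simp: pres_class_eq_iff)
      then show ?thesis by blast
    qed
    then show ?thesis by (auto simp: dicyclic_def presented_group_def f_def)
  qed
  ultimately have "card (carrier (dicyclic n)) = card ({..<2::nat} \<times> {..<2 * n})"
    by (metis card_image)
  then show ?thesis by (simp add: order_def)
qed

text \<open>A sequence is a list \<open>S\<close>, a subsequence of it a set \<open>I\<close> of (0-based) positions, and two
  sequences are identified when they have the same \<open>mset\<close>.\<close>

definition product_one_subsequence :: "('g, 'b) monoid_scheme \<Rightarrow> 'g list \<Rightarrow> nat set \<Rightarrow> bool" where
  "product_one_subsequence G S I \<longleftrightarrow>
     I \<noteq> {} \<and> I \<subseteq> {..<length S} \<and>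
     (\<exists>\<sigma>. \<sigma> permutes I \<and>
        foldr (mult G) (map (\<lambda>i. S ! \<sigma> i) (sorted_list_of_set I)) (one G) = one G)"

definition product_one_free :: "('g, 'b) monoid_scheme \<Rightarrow> 'g list \<Rightarrow> bool" where
  "product_one_free G S \<longleftrightarrow> \<not> (\<exists>I. product_one_subsequence G S I)"

end

theory Submission
  imports Defs
begin

text \<open>Write the terms of \<open>S\<close> as \<open>y\<^sup>c\<close> or \<open>x y\<^sup>b\<close>; the product of \<open>x y\<^sup>a\<close> and \<open>x y\<^sup>b\<close> is
  \<open>y\<close> to the power \<open>n + b - a\<close>, and the opposite order gives the negated exponent modulo \<open>2n\<close>.
  Suppose that at least two terms have the form \<open>x y\<^sup>b\<close>. If there were \<open>n\<close> or more terms \<open>y\<^sup>c\<close>,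
  their \<open>n + 1\<close> prefix sums would meet the translate by \<open>n + b - a\<close>, and a segment sum would
  cancel the pair. So more than \<open>n\<close> terms are of the form \<open>x y\<^sup>b\<close>, and two of them agree modulo
  \<open>n\<close>; such a pair must be equal and has product \<open>y\<^sup>n\<close>. The exponents \<open>b\<close> of the other terms are
  pairwise distinct modulo \<open>n\<close>, since two equal pairs have product \<open>1\<close>. For \<open>n \<ge> 3\<close> there is some
  term \<open>y\<^sup>c\<close>, and the at least \<open>n - 1\<close> remaining residues contain two with difference \<open>c\<close>; the
  corresponding three terms have product \<open>1\<close> or \<open>y\<^sup>n\<close>, and in the latter case the equal pair
  completes them to a product-one subsequence. Hence there is a single term \<open>x y\<^sup>s\<close>, and
  \<open>2n - 1\<close> exponents without zero-sum subsequence modulo \<open>2n\<close> are all equal to one generator.\<close>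

section \<open>Product-one subsequences as words\<close>

lemma permutes_map_eq:
  assumes "distinct xs" "distinct ys" "set xs = set ys"
  shows "\<exists>\<sigma>. \<sigma> permutes set xs \<and> map \<sigma> xs = ys"
proof -
  have len: "length xs = length ys"
    using assms by (metis distinct_card)
  define \<sigma> where "\<sigma> = permutation_of_list (zip xs ys)"
  have "\<sigma> permutes set xs"
    unfolding \<sigma>_def using assms len
    by (intro permutation_of_list_permutes list_permutesI) (auto simp: set_zip map_fst_zip map_snd_zip)
  moreover have "map \<sigma> xs = ys"
  proof (rule nth_equalityI)
    fix i assume "i < length (map \<sigma> xs)"
    then show "map \<sigma> xs ! i = ys ! i"
      using assms len by (simp add: \<sigma>_def permutation_of_list_def map_of_zip_nth)
  qed (use len in simp)
  ultimately show ?thesis by blast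
qed

text \<open>Positions and permutations are eliminated here. A word with multiset inside that of
  \<open>S\<close> extends by the remaining terms to a rearrangement of \<open>S\<close>, which
  assigns positions to its letters; conversely, a reordered subsequence is such a word.\<close>

lemma product_one_free_iff:
  "product_one_free G S \<longleftrightarrow>
    (\<forall>w. w \<noteq> [] \<longrightarrow> mset w \<subseteq># mset S \<longrightarrow> foldr (mult G) w (one G) \<noteq> one G)"
proof
  assume free: "product_one_free G S"
  show "\<forall>w. w \<noteq> [] \<longrightarrow> mset w \<subseteq># mset S \<longrightarrow> foldr (mult G) w (one G) \<noteq> one G"
  proof (intro allI impI notI)
    fix w assume w: "w \<noteq> []" "mset w \<subseteq># mset S" "foldr (mult G) w (one G) = one G"
    obtain w' where "mset w' = mset S - mset w"
      using ex_mset by blast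
    with w have "mset (w @ w') = mset S" by simp
    then obtain p where p: "p permutes {..<length S}" "permute_list p S = w @ w'"
      by (rule mset_eq_permutation)
    have len: "length w \<le> length S"
      using w(2) by (metis size_mset size_mset_mono)
    \<comment> \<open>\<open>ks\<close> lists the positions of \<open>S\<close> that supply the
      letters of \<open>w\<close>, in the order of \<open>w\<close>. The permutation demanded by the
      definition has to carry the sorted positions to this list.\<close>
    define ks where "ks = map p [0..<length w]"
    have w_eq: "w = map ((!) S) ks"
    proof (rule nth_equalityI)
      fix i assume i: "i < length w"
      then have "w ! i = permute_list p S ! i" using p(2) by (simp add: nth_append)
      also have "\<dots> = S ! p i" using i len p(1) by (intro permute_list_nth) auto
      finally show "w ! i = map ((!) S) ks ! i" using i by (simp add: ks_def)
    qed (simp add: ks_def)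
    have "distinct ks"
      using permutes_inj[OF p(1)] by (auto simp: ks_def distinct_map intro: inj_on_subset)
    then obtain \<sigma> where \<sigma>: "\<sigma> permutes set ks" "map \<sigma> (sorted_list_of_set (set ks)) = ks"
      using permutes_map_eq[of "sorted_list_of_set (set ks)" ks] by auto
    have "map (\<lambda>i. S ! \<sigma> i) (sorted_list_of_set (set ks))
        = map ((!) S) (map \<sigma> (sorted_list_of_set (set ks)))" by simp
    then have "map (\<lambda>i. S ! \<sigma> i) (sorted_list_of_set (set ks)) = w"
      unfolding \<sigma>(2) w_eq[symmetric] .
    moreover have "set ks = p ` {..<length w}" by (simp add: ks_def lessThan_atLeast0)
    then have "set ks \<subseteq> {..<length S}"
      using len permutes_image[OF p(1)] image_mono[of "{..<length w}" "{..<length S}" p] by simp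
    moreover have "set ks \<noteq> {}" using w(1) by (simp add: ks_def)
    ultimately have "product_one_subsequence G S (set ks)"
      unfolding product_one_subsequence_def using \<sigma>(1) w(3) by auto
    with free show False by (auto simp: product_one_free_def)
  qed
next
  assume free: "\<forall>w. w \<noteq> [] \<longrightarrow> mset w \<subseteq># mset S \<longrightarrow> foldr (mult G) w (one G) \<noteq> one G"
  show "product_one_free G S"
    unfolding product_one_free_def product_one_subsequence_def
  proof clarify
    fix I \<sigma>
    assume I: "I \<noteq> {}" "I \<subseteq> {..<length S}" and \<sigma>: "\<sigma> permutes I"
      and one: "foldr (mult G) (map (\<lambda>i. S ! \<sigma> i) (sorted_list_of_set I)) (one G) = one G"
    let ?w = "map (\<lambda>i. S ! \<sigma> i) (sorted_list_of_set I)"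
    have fin: "finite I" using I(2) finite_subset by blast
    have "mset ?w = image_mset ((!) S) (image_mset \<sigma> (mset_set I))"
      using fin mset_set_set[of "sorted_list_of_set I"] by (simp add: multiset.map_comp comp_def)
    also have "image_mset \<sigma> (mset_set I) = mset_set I"
      using \<sigma> by (simp add: image_mset_mset_set permutes_inj_on permutes_image)
    also have "image_mset ((!) S) (mset_set I) \<subseteq># image_mset ((!) S) (mset_set {..<length S})"
      using I(2) by (intro image_mset_subseteq_mono subset_imp_msubset_mset_set) auto
    also have "image_mset ((!) S) (mset_set {..<length S}) = mset (map ((!) S) [0..<length S])"
      by (simp add: lessThan_atLeast0)
    also have "\<dots> = mset S" by (simp only: map_nth)
    finally have "mset ?w \<subseteq># mset S" .
    moreover have "?w \<noteq> []" using I(1) fin by simp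
    ultimately show False using free one by blast
  qed
qed

section \<open>Repeated values and zero-sum free multisets\<close>

lemma not_distinct_map_pair:
  "\<not> distinct (map f xs) \<Longrightarrow> \<exists>u v zs. mset xs = mset (u # v # zs) \<and> f u = f v"
proof (induction xs)
  case (Cons x xs)
  show ?case
  proof (cases "f x \<in> f ` set xs")
    case True
    then obtain v where v: "v \<in> set xs" "f x = f v" by auto
    then have "mset (x # xs) = mset (x # v # remove1 v xs)" by simp
    with v(2) show ?thesis by blast
  next
    case False
    with Cons obtain u v zs where *: "mset xs = mset (u # v # zs)" "f u = f v" by auto
    then have "mset (x # xs) = mset (u # v # x # zs)" by simp
    with *(2) show ?thesis by blast
  qed
qed simp

text \<open>Sums are formed over the integers and only divisibility by \<open>m\<close> is tested,
  so exponents need no reduction to residues.\<close>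

definition zero_sum_free :: "int \<Rightarrow> int multiset \<Rightarrow> bool" where
  "zero_sum_free m C \<longleftrightarrow> (\<forall>D. D \<noteq> {#} \<longrightarrow> D \<subseteq># C \<longrightarrow> \<not> m dvd \<Sum>\<^sub># D)"

text \<open>The witness is the segment of \<open>cs\<close> between positions \<open>i\<close> and
  \<open>j\<close>. This turns coincidences among prefix sums into statements about
  submultisets.\<close>

lemma take_sum_diff:
  fixes cs :: "int list"
  assumes "i < j" "j \<le> length cs"
  obtains D where "D \<noteq> {#}" "D \<subseteq># mset cs"
    "sum_list (take j cs) = sum_list (take i cs) + \<Sum>\<^sub># D"
proof
  let ?d = "drop i (take j cs)"
  show "mset ?d \<noteq> {#}" using assms by simp
  have "take i cs @ ?d @ drop j cs = cs"
    using assms by (metis append.assoc append_take_drop_id less_imp_le take_take min.absorb1)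
  then have "mset cs = mset (take i cs) + mset ?d + mset (drop j cs)"
    by (metis mset_append add.assoc)
  then show "mset ?d \<subseteq># mset cs" by simp
  have "take j cs = take i cs @ ?d"
    using assms by (metis append_take_drop_id less_imp_le take_take min.absorb1)
  then show "sum_list (take j cs) = sum_list (take i cs) + \<Sum>\<^sub># (mset ?d)"
    by (metis sum_list_append sum_mset_sum_list)
qed

text \<open>Two congruent prefix sums would make the segment between them a zero sum. The empty
  prefix counts too, so there are \<open>length cs + 1\<close> distinct residues.\<close>

lemma zero_sum_free_inj:
  assumes "zero_sum_free m (mset cs)"
  shows "inj_on (\<lambda>i. sum_list (take i cs) mod m) {..length cs}"
proof (rule linorder_inj_onI)
  fix i j assume "i < j" "j \<in> {..length cs}"
  then obtain D where D: "D \<noteq> {#}" "D \<subseteq># mset cs"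
    "sum_list (take j cs) = sum_list (take i cs) + \<Sum>\<^sub># D"
    using take_sum_diff by (metis atMost_iff)
  with assms have "\<not> m dvd sum_list (take j cs) - sum_list (take i cs)"
    by (simp add: zero_sum_free_def)
  then show "sum_list (take i cs) mod m \<noteq> sum_list (take j cs) mod m"
    by (metis mod_eq_dvd_iff)
qed auto

text \<open>Pigeonhole: the \<open>size C + 1\<close> prefix sums and their translates by
  \<open>d\<close> are too many to be disjoint modulo \<open>m\<close>. Which of the two coinciding
  prefixes is longer decides the sign of \<open>d\<close>.\<close>

lemma zero_sum_free_signed_sum:
  assumes "zero_sum_free m C" "0 < m" "m < 2 * (int (size C) + 1)"
  obtains D where "D \<subseteq># C" "m dvd d + \<Sum>\<^sub># D \<or> m dvd - d + \<Sum>\<^sub># D"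
proof -
  obtain cs where cs: "C = mset cs" by (metis ex_mset)
  let ?p = "\<lambda>i. sum_list (take i cs)" and ?I = "{..length cs}"
  have inj: "inj_on (\<lambda>i. ?p i mod m) ?I"
    using assms(1) zero_sum_free_inj cs by blast
  have inj': "inj_on (\<lambda>i. (?p i + d) mod m) ?I"
  proof (rule inj_onI)
    fix i j assume ij: "i \<in> ?I" "j \<in> ?I" and "(?p i + d) mod m = (?p j + d) mod m"
    then have "?p i mod m = ?p j mod m" by (simp add: mod_eq_dvd_iff)
    with inj ij show "i = j" by (auto dest: inj_onD)
  qed
  let ?A = "(\<lambda>i. ?p i mod m) ` ?I" and ?B = "(\<lambda>i. (?p i + d) mod m) ` ?I"
  have "?A \<inter> ?B \<noteq> {}"
  proof
    assume "?A \<inter> ?B = {}"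
    then have "card (?A \<union> ?B) = card ?A + card ?B" by (intro card_Un_disjoint) auto
    also have "\<dots> = 2 * (size C + 1)"
      using card_image[OF inj] card_image[OF inj'] cs by simp
    finally have "int (card (?A \<union> ?B)) > m" using assms(3) by simp
    moreover have "?A \<union> ?B \<subseteq> {0..<m}" using assms(2) by auto
    then have "card (?A \<union> ?B) \<le> card {0..<m}" by (intro card_mono) auto
    ultimately show False using assms(2) by simp
  qed
  then obtain i j where ij: "i \<in> ?I" "j \<in> ?I" "?p i mod m = (?p j + d) mod m" by auto
  consider "i < j" | "i = j" | "j < i" by linarith
  then show thesis
  proof cases
    case 1
    with ij obtain D where "D \<subseteq># mset cs" "?p j = ?p i + \<Sum>\<^sub># D"
      using take_sum_diff by (metis atMost_iff)
    with ij(3) that[of D] cs show thesis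
      by (simp add: mod_eq_dvd_iff) (metis add.commute dvd_minus_iff minus_add_distrib uminus_add_conv_diff)
  next
    case 2
    with ij(3) that[of "{#}"] show thesis by (simp add: mod_eq_dvd_iff)
  next
    case 3
    with ij obtain D where "D \<subseteq># mset cs" "?p i = ?p j + \<Sum>\<^sub># D"
      using take_sum_diff by (metis atMost_iff)
    with ij(3) that[of D] cs show thesis
      by (simp add: mod_eq_dvd_iff)
  qed
qed

text \<open>With \<open>a\<close> and \<open>b\<close> listed first, the \<open>m\<close> distinct
  prefix sums exhaust all residues, so one is congruent to \<open>b\<close>. The empty prefix would
  make \<open>b\<close> a zero sum; a prefix containing \<open>b\<close> would, after deletion of
  \<open>b\<close>, leave a zero sum. Only the prefix \<open>a\<close> remains.\<close>

lemma zero_sum_free_max_cong: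
  assumes zsf: "zero_sum_free m C" and m: "0 < m" "int (size C) = m - 1"
    and ab: "{#a, b#} \<subseteq># C"
  shows "a mod m = b mod m"
proof (rule ccontr)
  assume ne: "a mod m \<noteq> b mod m"
  obtain ds where ds: "mset ds = C - {#a, b#}" by (metis ex_mset)
  define cs where "cs = a # b # ds"
  have C: "C = mset cs"
    using ab ds unfolding cs_def by (metis add_mset_add_single mset.simps(2) subset_mset.diff_add union_mset_add_mset_right add.commute add_mset_commute)
  let ?p = "\<lambda>i. sum_list (take i cs) mod m"
  have inj: "inj_on ?p {..length cs}" using zsf C zero_sum_free_inj by blast
  have "?p ` {..length cs} \<subseteq> {0..<m}" using m by auto
  moreover have "card (?p ` {..length cs}) = card {0..<m}"
    using card_image[OF inj] C m by simp
  ultimately have "?p ` {..length cs} = {0..<m}" by (intro card_subset_eq) auto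
  moreover have "b mod m \<in> {0..<m}" using m by simp
  ultimately obtain i where i: "i \<le> length cs" "?p i = b mod m" by (metis (no_types, lifting) atMost_iff imageE)
  have nd: "\<not> m dvd \<Sum>\<^sub># D" if "D \<noteq> {#}" "D \<subseteq># mset cs" for D
    using zsf C that by (simp add: zero_sum_free_def)
  consider "i = 0" | "i = 1" | k where "i = Suc (Suc k)" by (metis One_nat_def not0_implies_Suc)
  then show False
  proof cases
    case 1
    with i(2) nd[of "{#b#}"] show False by (simp add: cs_def dvd_eq_mod_eq_0)
  next
    case 2
    with i(2) ne show False by (simp add: cs_def)
  next
    case 3
    have "m dvd a + sum_list (take k ds)"
      using i(2) 3 by (simp add: cs_def mod_eq_dvd_iff algebra_simps)
    moreover have "mset ds = mset (take k ds) + mset (drop k ds)"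
      by (metis append_take_drop_id mset_append)
    then have "mset (a # take k ds) \<subseteq># mset cs"
      by (simp add: cs_def)
    ultimately show False using nd[of "mset (a # take k ds)"]
      by (simp add: sum_mset_sum_list)
  qed
qed


lemma card_residues_le:
  fixes f :: "'b \<Rightarrow> int"
  assumes "inj_on f A" "f ` A \<subseteq> {0..<int m}"
  shows "card A \<le> m"
  using card_mono[OF _ assms(2)] card_image[OF assms(1)] by simp

text \<open>This is the upper bound for the Davenport constant of the cyclic group of order
  \<open>m\<close>, obtained by counting prefix sums.\<close>

lemma zero_sum_free_size_less:
  assumes "zero_sum_free (int m) C" "0 < m"
  shows "size C < m"
proof -
  obtain cs where cs: "C = mset cs" by (metis ex_mset)
  have "card {..length cs} \<le> m"
    using assms cs by (intro card_residues_le[OF zero_sum_free_inj]) auto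
  then show ?thesis using cs by simp
qed

section \<open>Exponents of a product-one free sequence of length \<open>2 * n\<close>\<close>

text \<open>\<open>B\<close> collects the exponents \<open>b\<close> of the terms x y^b and
  \<open>C\<close> those of the powers of y. The last three assumptions express freeness for words
  with zero, two or four terms from \<open>B\<close> followed by powers of y. Since
  \<open>{#a, b#}\<close> is unordered, \<open>pair\<close> covers both orders of the two
  terms.\<close>

context
  fixes n :: nat and B C :: "int multiset"
  assumes n_ge_2: "2 \<le> n" and size_B_C: "size B + size C = 2 * n"
    and zsf: "zero_sum_free (int (2 * n)) C"
    and pair: "\<And>a b D. {#a, b#} \<subseteq># B \<Longrightarrow> D \<subseteq># C \<Longrightarrow>
      \<not> int (2 * n) dvd int n + b - a + \<Sum>\<^sub># D"
    and two_pairs: "\<And>a b u v D. {#a, b, u, v#} \<subseteq># B \<Longrightarrow> D \<subseteq># C \<Longrightarrow>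
      \<not> int (2 * n) dvd b - a + v - u + \<Sum>\<^sub># D"
begin

lemma size_B_pos: "0 < size B"
  using zero_sum_free_size_less[OF zsf] n_ge_2 size_B_C by simp

text \<open>The signed-sum lemma is applied to the exponent \<open>int n + b - a\<close> of the
  product of two terms from \<open>B\<close>. Swapping the two terms negates it modulo
  \<open>2 * n\<close>, so either sign contradicts \<open>pair\<close>.\<close>

lemma size_C_less:
  assumes "2 \<le> size B"
  shows "size C < n"
proof (rule ccontr)
  assume "\<not> size C < n"
  obtain bs where bs: "B = mset bs" by (metis ex_mset)
  with assms obtain a b zs where "bs = a # b # zs"
    by (cases bs; cases "tl bs") auto
  with bs have ab: "{#a, b#} \<subseteq># B" "{#b, a#} \<subseteq># B" by simp_all
  obtain D where D: "D \<subseteq># C" "int (2 * n) dvd (int n + b - a) + \<Sum>\<^sub># D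
      \<or> int (2 * n) dvd - (int n + b - a) + \<Sum>\<^sub># D"
    using zsf n_ge_2 \<open>\<not> size C < n\<close>
    by (elim zero_sum_free_signed_sum[where d = "int n + b - a"]) auto
  have "\<not> int (2 * n) dvd - (int n + b - a) + \<Sum>\<^sub># D"
  proof
    assume "int (2 * n) dvd - (int n + b - a) + \<Sum>\<^sub># D"
    then have "int (2 * n) dvd (- (int n + b - a) + \<Sum>\<^sub># D) + int (2 * n)"
      by (rule dvd_add[OF _ dvd_refl])
    also have "\<dots> = int n + a - b + \<Sum>\<^sub># D" by simp
    finally show False using pair[OF ab(2) D(1)] by blast
  qed
  with D pair[OF ab(1) D(1)] show False by blast
qed

text \<open>The difference is a multiple \<open>int n * q\<close>. An odd \<open>q\<close> would
  cancel the summand \<open>int n\<close>, making the product of the two terms trivial.\<close>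

lemma pair_mod_eq:
  assumes "{#a, b#} \<subseteq># B" "a mod int n = b mod int n"
  shows "a mod int (2 * n) = b mod int (2 * n)"
proof -
  obtain q where q: "b - a = int n * q"
    using assms(2) by (metis dvdE mod_eq_dvd_iff)
  have "even q"
  proof (rule ccontr)
    assume "odd q"
    then obtain r where "q = 2 * r + 1" by (elim oddE)
    with q have "int n + b - a + \<Sum>\<^sub># {#} = int (2 * n) * (r + 1)" by (simp add: algebra_simps)
    then show False using pair[OF assms(1), of "{#}"] by simp
  qed
  then obtain r where "q = 2 * r" by (elim evenE)
  with q have "b - a = int (2 * n) * r" by simp
  then show ?thesis by (metis dvd_triv_left mod_eq_dvd_iff)
qed

text \<open>By \<open>size_C_less\<close> there are more than \<open>n\<close> exponents in
  \<open>B\<close>, so two agree modulo \<open>n\<close>, hence modulo \<open>2 * n\<close>. A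
  second such pair among the rest would give y^n y^n = 1.\<close>

lemma repeated_pair_split:
  assumes "2 \<le> size B"
  obtains a b rs where "B = mset (a # b # rs)" "a mod int (2 * n) = b mod int (2 * n)"
    "distinct (map (\<lambda>u. u mod int n) rs)"
proof -
  obtain bs where bs: "B = mset bs" by (metis ex_mset)
  have long: "n < length bs" using size_C_less[OF assms] size_B_C bs by simp
  have "\<not> distinct (map (\<lambda>u. u mod int n) bs)"
  proof
    assume "distinct (map (\<lambda>u. u mod int n) bs)"
    then have "card ((\<lambda>u. u mod int n) ` set bs) = length bs"
      by (metis distinct_card length_map set_map)
    moreover have "card ((\<lambda>u. u mod int n) ` set bs) \<le> n"
      using n_ge_2 by (intro card_residues_le[where f = "\<lambda>u. u"]) auto
    ultimately show False using long by simp
  qed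
  then obtain a b rs where ab: "mset bs = mset (a # b # rs)" "a mod int n = b mod int n"
    using not_distinct_map_pair[of "\<lambda>u. u mod int n" bs] by blast
  then have ab_mod: "a mod int (2 * n) = b mod int (2 * n)"
    using bs by (intro pair_mod_eq) simp_all
  have "distinct (map (\<lambda>u. u mod int n) rs)"
  proof (rule ccontr)
    assume "\<not> distinct (map (\<lambda>u. u mod int n) rs)"
    then obtain u v zs where uv: "mset rs = mset (u # v # zs)" "u mod int n = v mod int n"
      using not_distinct_map_pair by blast
    then have "u mod int (2 * n) = v mod int (2 * n)"
      using bs ab by (intro pair_mod_eq) simp_all
    then have "int (2 * n) dvd (b - a) + (v - u)"
      using ab_mod by (intro dvd_add) (metis mod_eq_dvd_iff)+
    then have "int (2 * n) dvd b - a + v - u + \<Sum>\<^sub># {#}" by (simp add: algebra_simps)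
    moreover have "{#a, b, u, v#} \<subseteq># B" using bs ab uv by simp
    ultimately show False using two_pairs[of a b u v "{#}"] by simp
  qed
  with ab ab_mod bs that show thesis by metis
qed

text \<open>A repeated pair \<open>a \<equiv> b\<close> contributes the central element \<open>y\<^sup>n\<close>, so the
  remaining terms only matter modulo \<open>n\<close>.\<close>

lemma repeated_pair_mod:
  assumes "{#a, b#} \<subseteq># B" "a mod int (2 * n) = b mod int (2 * n)" "c \<in># C"
  shows "c mod int n \<noteq> 0"
proof
  assume "c mod int n = 0"
  then obtain q where q: "c = int n * q" by auto
  obtain s where s: "b - a = int (2 * n) * s" using assms(2) by (metis dvdE mod_eq_dvd_iff)
  show False
  \<comment> \<open>For even \<open>q\<close> the term y^c is itself trivial; for odd
    \<open>q\<close> it equals y^n and cancels against the product of the repeated pair.\<close>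
  proof (cases "even q")
    case True
    then obtain r where "q = 2 * r" by (elim evenE)
    with q have "int (2 * n) dvd \<Sum>\<^sub># {#c#}" by simp
    with zsf[unfolded zero_sum_free_def, rule_format, of "{#c#}"] assms(3) show False by simp
  next
    case False
    then obtain r where "q = 2 * r + 1" by (elim oddE)
    with q s have "int n + b - a + \<Sum>\<^sub># {#c#} = int (2 * n) * (r + s + 1)"
      by (simp add: algebra_simps)
    then have "int (2 * n) dvd int n + b - a + \<Sum>\<^sub># {#c#}" by (metis dvd_triv_left)
    with pair[OF assms(1), of "{#c#}"] assms(3) show False by simp
  qed
qed

text \<open>Under the divisibility, the terms with exponents \<open>u\<close>, \<open>v\<close>,
  \<open>c\<close> multiply to 1 or to y^n. In the second case, which is the one with even quotient,
  the repeated pair supplies another factor y^n.\<close>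

lemma repeated_pair_three_sum:
  assumes "{#a, b, u, v#} \<subseteq># B" "a mod int (2 * n) = b mod int (2 * n)" "c \<in># C"
  shows "\<not> int n dvd v - u + c"
proof
  assume "int n dvd v - u + c"
  then obtain q where q: "v - u + c = int n * q" by auto
  obtain s where s: "b - a = int (2 * n) * s" using assms(2) by (metis dvdE mod_eq_dvd_iff)
  have uv: "{#u, v#} \<subseteq># B"
    by (rule subset_mset.order_trans[OF _ assms(1)]) simp
  show False
  proof (cases "even q")
    case True
    then obtain r where "q = 2 * r" by (elim evenE)
    with q s have "b - a + v - u + \<Sum>\<^sub># {#c#} = int (2 * n) * (r + s)"
      by (simp add: algebra_simps)
    then have "int (2 * n) dvd b - a + v - u + \<Sum>\<^sub># {#c#}" by (metis dvd_triv_left)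
    with two_pairs[OF assms(1), of "{#c#}"] assms(3) show False by simp
  next
    case False
    then obtain r where "q = 2 * r + 1" by (elim oddE)
    with q have "int n + v - u + \<Sum>\<^sub># {#c#} = int (2 * n) * (r + 1)"
      by (simp add: algebra_simps)
    then have "int (2 * n) dvd int n + v - u + \<Sum>\<^sub># {#c#}" by (metis dvd_triv_left)
    with pair[OF uv, of "{#c#}"] assms(3) show False by simp
  qed
qed

text \<open>The residues of \<open>rs\<close> modulo \<open>n\<close> and their translates by some
  \<open>c\<close> from \<open>C\<close> number at least \<open>2 * (n - 1)\<close>, which exceeds
  \<open>n\<close>, so they overlap. This yields the three terms excluded by
  \<open>repeated_pair_three_sum\<close>. For \<open>n = 2\<close> this count and the one producing
  \<open>c\<close> both fail.\<close>

lemma size_B_eq_1: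
  assumes "3 \<le> n"
  shows "size B = 1"
proof (rule ccontr)
  assume "size B \<noteq> 1"
  with size_B_pos have ge2: "2 \<le> size B" by simp
  then obtain a b rs where B: "B = mset (a # b # rs)"
    and ab: "a mod int (2 * n) = b mod int (2 * n)"
    and dist: "distinct (map (\<lambda>u. u mod int n) rs)"
    by (rule repeated_pair_split)
  let ?A = "(\<lambda>u. u mod int n) ` set rs"
  have card_A: "card ?A = length rs" using dist by (metis distinct_card length_map set_map)
  have A_sub: "?A \<subseteq> {0..<int n}" using assms by auto
  have "card ?A \<le> n" using A_sub by (intro card_residues_le[where f = "\<lambda>u. u"]) auto
  \<comment> \<open>Distinct residues bound \<open>size B\<close> by \<open>n + 2\<close>, which is
    less than \<open>2 * n\<close> because \<open>3 <= n\<close>.\<close>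
  then have "0 < size C" using size_B_C B card_A assms by simp
  then obtain c where c: "c \<in># C" by (metis multiset_nonemptyE size_empty less_irrefl)
  have c0: "c mod int n \<noteq> 0" using repeated_pair_mod[OF _ ab c] B by simp
  let ?A' = "(\<lambda>u. (u + c) mod int n) ` ?A"
  have "inj_on (\<lambda>u. (u + c) mod int n) ?A"
  proof (rule inj_onI)
    fix x y assume "x \<in> ?A" "y \<in> ?A" "(x + c) mod int n = (y + c) mod int n"
    then have "x mod int n = y mod int n" by (simp add: mod_eq_dvd_iff)
    moreover have "x mod int n = x" "y mod int n = y" using \<open>x \<in> ?A\<close> \<open>y \<in> ?A\<close> by auto
    ultimately show "x = y" by simp
  qed
  then have card_A': "card ?A' = length rs" using card_A by (simp only: card_image)
  have "?A \<inter> ?A' \<noteq> {}"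
  proof
    assume "?A \<inter> ?A' = {}"
    then have "card (?A \<union> ?A') = card ?A + card ?A'" by (intro card_Un_disjoint) auto
    then have "card (?A \<union> ?A') = 2 * length rs" using card_A card_A' by simp
    moreover have "card (?A \<union> ?A') \<le> n"
      using A_sub assms by (intro card_residues_le[where f = "\<lambda>u. u"]) auto
    moreover have "n - 1 \<le> length rs" using size_C_less[OF ge2] size_B_C B by simp
    ultimately show False using assms by simp
  qed
  then obtain u v where uv: "u \<in> set rs" "v \<in> set rs" "u mod int n = (v mod int n + c) mod int n"
    by auto
  then have dvd: "int n dvd v - u + c"
    by (metis add_diff_eq add.commute diff_add_eq mod_add_left_eq mod_eq_dvd_iff)
  \<comment> \<open>The coinciding residues must come from different entries for
    \<open>{#u, v#}\<close> to be a submultiset; this is where \<open>c\<close> being nonzero modulo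
    \<open>n\<close> enters.\<close>
  have "u \<noteq> v"
  proof
    assume "u = v"
    with dvd c0 show False by simp
  qed
  with uv(1,2) have "{#u, v#} \<subseteq># mset rs"
    by (auto simp: insert_subset_eq_iff in_diff_count)
  with B have "{#a, b, u, v#} \<subseteq># B" by simp
  from repeated_pair_three_sum[OF this ab c] dvd show False by blast
qed

text \<open>Here \<open>C\<close> has at most one element. By \<open>pair_mod_eq\<close>, exponents
  in \<open>B\<close> of equal parity agree modulo 4, so only parities need to be compared with that
  of the repeated pair.\<close>

lemma n_eq_2_exponents:
  assumes "n = 2" "2 \<le> size B"
  shows "(\<exists>a b u c. B = {#a, b, u#} \<and> C = {#c#} \<and> odd c \<and> a mod 4 = b mod 4 \<and> u mod 4 = b mod 4)
    \<or> (\<exists>a b u v. B = {#a, b, u, v#} \<and> C = {#} \<and> odd (v - b) \<and> a mod 4 = b mod 4 \<and> u mod 4 = b mod 4)"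
proof -
  from assms(2) obtain a b rs where B: "B = mset (a # b # rs)"
    and ab: "a mod int (2 * n) = b mod int (2 * n)"
    and dist: "distinct (map (\<lambda>u. u mod int n) rs)"
    by (rule repeated_pair_split)
  have mod4: "u mod 4 = b mod 4" if "u \<in> set rs" "even (u - b)" for u
  proof -
    have "{#u, b#} \<subseteq># B" using that(1) B by (simp add: insert_subset_eq_iff)
    moreover have "u mod int n = b mod int n" using that(2) assms(1) by (simp add: mod_eq_dvd_iff)
    ultimately show ?thesis using pair_mod_eq[of u b] assms(1) by simp
  qed
  have "size C < 2" using size_C_less[OF assms(2)] assms(1) by simp
  then consider "size C = 0" | "size C = 1" by linarith
  then show ?thesis
  proof cases
    case 1
    then have C: "C = {#}" by simp
    with size_B_C B assms(1) have "length rs = 2" by simp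
    then obtain u v where rs: "rs = [u, v]" by (auto simp: length_Suc_conv numeral_2_eq_2)
    have uv: "odd (u - v)" using dist assms(1) by (auto simp: rs mod_eq_dvd_iff)
    show ?thesis
    proof (cases "even (u - b)")
      case True
      moreover from this uv have "odd (v - b)" by simp
      ultimately have "B = {#a, b, u, v#} \<and> C = {#} \<and> odd (v - b) \<and> a mod 4 = b mod 4 \<and> u mod 4 = b mod 4"
        using B C ab assms(1) rs mod4[of u] by simp
      then show ?thesis by blast
    next
      case False
      moreover from this uv have "even (v - b)" by simp
      ultimately have "B = {#a, b, v, u#} \<and> C = {#} \<and> odd (u - b) \<and> a mod 4 = b mod 4 \<and> v mod 4 = b mod 4"
        using B C ab assms(1) rs mod4[of v] by simp
      then show ?thesis by blast
    qed
  next
    case 2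
    then obtain c where C: "C = {#c#}" by (metis size_1_singleton_mset)
    with size_B_C B assms(1) have "length rs = 1" by simp
    then obtain u where rs: "rs = [u]" by (auto simp: length_Suc_conv)
    have odd_c: "odd c"
      using repeated_pair_mod[OF _ ab, of c] B C assms(1) by (simp add: odd_iff_mod_2_eq_one)
    have "even (u - b)"
    proof (rule ccontr)
      assume odd_ub: "odd (u - b)"
      have "{#u, b#} \<subseteq># B" "{#b, u#} \<subseteq># B" using B rs by simp_all
      \<comment> \<open>Both numbers are even, and they differ by \<open>2 * (b - u)\<close>, which
        is 2 modulo 4; so one of them is divisible by 4.\<close>
      then have "\<not> 4 dvd 2 + b - u + c" "\<not> 4 dvd 2 + u - b + c"
        using pair[of u b "{#c#}"] pair[of b u "{#c#}"] C assms(1) by simp_all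
      with odd_ub odd_c show False by presburger
    qed
    with mod4[of u] rs B C ab assms(1) odd_c
    have "B = {#a, b, u#} \<and> C = {#c#} \<and> odd c \<and> a mod 4 = b mod 4 \<and> u mod 4 = b mod 4" by simp
    then show ?thesis by blast
  qed
qed

end

section \<open>Sequences with all but one term equal\<close>

lemma mset_subseteq_replicate:
  assumes "mset w \<subseteq># replicate_mset k a"
  shows "set w \<subseteq> {a}" "length w \<le> k"
  using set_mset_mono[OF assms] size_mset_mono[OF assms] by (auto split: if_splits)

text \<open>A word over these terms is a short power of \<open>a\<close> or has the form a^i b a^j,
  and each shape is excluded by one hypothesis. All families in the classification are of this
  kind.\<close>

lemma product_one_free_power_append:
  assumes "group G" and a: "a \<in> carrier G" and b: "b \<in> carrier G"
    and pow: "\<And>j :: nat. 0 < j \<Longrightarrow> j < m \<Longrightarrow> a [^]\<^bsub>G\<^esub> j \<noteq> \<one>\<^bsub>G\<^esub>"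
    and split: "\<And>i j :: nat. i < m \<Longrightarrow> j < m \<Longrightarrow>
      a [^]\<^bsub>G\<^esub> i \<otimes>\<^bsub>G\<^esub> (b \<otimes>\<^bsub>G\<^esub> a [^]\<^bsub>G\<^esub> j) \<noteq> \<one>\<^bsub>G\<^esub>"
    and S: "mset S = mset (replicate (m - 1) a @ [b])" and "0 < m"
  shows "product_one_free G S"
  unfolding product_one_free_iff
proof (intro allI impI)
  interpret group G by fact
  have foldr_a: "foldr (\<otimes>\<^bsub>G\<^esub>) (replicate j a) z = a [^]\<^bsub>G\<^esub> j \<otimes>\<^bsub>G\<^esub> z"
    if "z \<in> carrier G" for j z
  proof (induction j)
    case (Suc j)
    then show ?case using a that
      by (simp add: m_assoc[symmetric]) (metis nat_pow_Suc nat_pow_Suc2)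
  qed (use that in simp)
  fix w assume w: "w \<noteq> []" "mset w \<subseteq># mset S"
  show "foldr (\<otimes>\<^bsub>G\<^esub>) w \<one>\<^bsub>G\<^esub> \<noteq> \<one>\<^bsub>G\<^esub>"
  proof (cases "set w \<subseteq> {a} \<and> length w < m")
    case True
    then have "w = replicate (length w) a" by (metis replicate_eqI singletonD subsetD)
    then show ?thesis using foldr_a[of "\<one>\<^bsub>G\<^esub>" "length w"] pow[of "length w"] True w(1) a by simp
  next
    case False
    \<comment> \<open>A word avoiding \<open>b\<close> consists of at most \<open>m - 1\<close>
      copies of \<open>a\<close> and belongs to the previous case. This also copes with
      \<open>b = a\<close>.\<close>
    have "b \<in> set w"
    proof (rule ccontr)
      assume "b \<notin> set w"
      then have "mset w \<subseteq># replicate_mset (m - 1) a"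
        using w(2) subset_eq_diff_conv[of "mset w" "{#b#}" "replicate_mset (m - 1) a"]
        unfolding S by (simp add: diff_single_trivial)
      then have "set w \<subseteq> {a}" "length w \<le> m - 1"
        by (rule mset_subseteq_replicate)+
      with False \<open>0 < m\<close> show False by simp
    qed
    then obtain us vs where w_eq: "w = us @ b # vs" by (metis split_list)
    then have "mset (us @ vs) \<subseteq># replicate_mset (m - 1) a"
      using w(2) unfolding S by simp
    from mset_subseteq_replicate[OF this]
    have "set us \<union> set vs \<subseteq> {a}" "length us + length vs \<le> m - 1"
      by simp_all
    then have "us = replicate (length us) a" "vs = replicate (length vs) a"
      and "length us < m" "length vs < m" using \<open>0 < m\<close>
      by (auto intro!: replicate_eqI)
    then show ?thesis
      using foldr_a[of "\<one>\<^bsub>G\<^esub>" "length vs"] a b split[of "length us" "length vs"]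
        foldr_a[of "b \<otimes>\<^bsub>G\<^esub> a [^]\<^bsub>G\<^esub> length vs" "length us"]
      unfolding w_eq by (metis (no_types, lifting) comp_apply foldr.simps(2) foldr_append m_closed nat_pow_closed one_closed r_one)
  qed
qed

section \<open>Exponent arithmetic in the dicyclic group\<close>

text \<open>\<open>Y c\<close> stands for y^c and \<open>X b\<close> for x y^b. Integer exponents
  turn every product into integer arithmetic, and \<open>Y_eq_one\<close> recovers the period
  \<open>2 * n\<close>. The rest of the argument never touches the presentation.\<close>

locale dicyclic_exponents = group G for G (structure) +
  fixes n :: nat and X Y :: "int \<Rightarrow> 'a"
  assumes n_ge_2: "2 \<le> n"
    and X_closed [simp]: "X b \<in> carrier G" and Y_closed [simp]: "Y c \<in> carrier G"
    and Y_Y [simp]: "Y c \<otimes> Y d = Y (c + d)"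
    and Y_X [simp]: "Y c \<otimes> X b = X (b - c)"
    and X_Y [simp]: "X b \<otimes> Y c = X (b + c)"
    and X_X [simp]: "X a \<otimes> X b = Y (int n + b - a)"
    and Y_eq_one: "Y c = \<one> \<longleftrightarrow> 2 * int n dvd c"
    and X_neq_one [simp]: "X b \<noteq> \<one>"
    and carrier_eq: "carrier G = range X \<union> range Y"
begin

lemma Y_0 [simp]: "Y 0 = \<one>"
  by (simp add: Y_eq_one)

lemma Y_cong: "c mod (2 * int n) = d mod (2 * int n) \<Longrightarrow> Y c = Y d"
proof -
  assume "c mod (2 * int n) = d mod (2 * int n)"
  then have "Y (c - d) = \<one>" by (simp add: Y_eq_one mod_eq_dvd_iff)
  moreover have "Y (c - d) \<otimes> Y d = Y c" by (subst Y_Y) simp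
  ultimately show ?thesis by simp
qed

lemma X_cong: "c mod (2 * int n) = d mod (2 * int n) \<Longrightarrow> X c = X d"
  using X_Y[of 0 c] X_Y[of 0 d] Y_cong[of c d] by simp

lemma Y_pow: "Y c [^] j = Y (int j * c)"
  by (induction j) (simp_all add: algebra_simps)

lemma foldr_Y: "foldr (\<otimes>) (map Y cs) \<one> = Y (sum_list cs)"
  by (induction cs) (simp_all del: Y_0 add: Y_0[symmetric])

lemma exponents_exist:
  "set S \<subseteq> carrier G \<Longrightarrow> \<exists>B C. mset S = image_mset X B + image_mset Y C"
proof (induction S)
  case Nil
  have "mset [] = image_mset X {#} + image_mset Y {#}" by simp
  then show ?case by blast
next
  case (Cons g S)
  then obtain B C where S: "mset S = image_mset X B + image_mset Y C" by auto
  from Cons.prems carrier_eq consider b where "g = X b" | c where "g = Y c" by auto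
  then show ?case
  proof cases
    case 1
    with S have "mset (g # S) = image_mset X (add_mset b B) + image_mset Y C" by simp
    then show ?thesis by blast
  next
    case 2
    with S have "mset (g # S) = image_mset X B + image_mset Y (add_mset c C)" by simp
    then show ?thesis by blast
  qed
qed

text \<open>The conclusions are the hypotheses of the combinatorial context above. They come from
  evaluating words with zero, two or four \<open>X\<close> terms followed by \<open>Y\<close>
  terms.\<close>

lemma free_exponents:
  assumes free: "product_one_free G S" and S: "mset S = image_mset X B + image_mset Y C"
  shows "zero_sum_free (int (2 * n)) C"
    and "\<And>a b D. {#a, b#} \<subseteq># B \<Longrightarrow> D \<subseteq># C \<Longrightarrow>
      \<not> int (2 * n) dvd int n + b - a + \<Sum>\<^sub># D"
    and "\<And>a b u v D. {#a, b, u, v#} \<subseteq># B \<Longrightarrow> D \<subseteq># C \<Longrightarrow>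
      \<not> int (2 * n) dvd b - a + v - u + \<Sum>\<^sub># D"
proof -
  have word: "foldr (\<otimes>) (map X us @ map Y ds) \<one> \<noteq> \<one>"
    if "us @ ds \<noteq> []" "mset us \<subseteq># B" "mset ds \<subseteq># C" for us ds
  proof -
    have "mset (map X us @ map Y ds) \<subseteq># mset S"
      unfolding S using that by (simp add: subset_mset.add_mono image_mset_subseteq_mono)
    moreover have "map X us @ map Y ds \<noteq> []" using that(1) by simp
    ultimately show ?thesis using free unfolding product_one_free_iff by blast
  qed
  show "zero_sum_free (int (2 * n)) C"
    unfolding zero_sum_free_def
  proof (intro allI impI)
    fix D assume D: "D \<noteq> {#}" "D \<subseteq># C"
    obtain ds where "D = mset ds" by (metis ex_mset)
    with D word[of "[]" ds] show "\<not> int (2 * n) dvd \<Sum>\<^sub># D"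
      by (simp add: foldr_Y Y_eq_one sum_mset_sum_list)
  qed
  show "\<not> int (2 * n) dvd int n + b - a + \<Sum>\<^sub># D"
    if "{#a, b#} \<subseteq># B" "D \<subseteq># C" for a b D
  proof -
    obtain ds where "D = mset ds" by (metis ex_mset)
    with that word[of "[a, b]" ds] show ?thesis
      by (simp add: foldr_Y Y_eq_one sum_mset_sum_list algebra_simps)
  qed
  show "\<not> int (2 * n) dvd b - a + v - u + \<Sum>\<^sub># D"
    if "{#a, b, u, v#} \<subseteq># B" "D \<subseteq># C" for a b u v D
  proof -
    obtain ds where "D = mset ds" by (metis ex_mset)
    with that word[of "[a, b, u, v]" ds]
    \<comment> \<open>Each of the two pairs contributes a summand \<open>int n\<close>; together
      they form a full period, which is then dropped.\<close>
    have "\<not> int (2 * n) dvd (b - a + v - u + \<Sum>\<^sub># D) + int (2 * n)"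
      by (simp add: foldr_Y Y_eq_one sum_mset_sum_list algebra_simps)
    then show ?thesis by (metis dvd_add dvd_refl)
  qed
qed

section \<open>Classification in terms of exponents\<close>

text \<open>Coprimality gives \<open>Y t\<close> the order \<open>2 * n\<close>, so fewer copies
  cannot multiply to 1; a word using the single \<open>X s\<close> evaluates to some
  \<open>X b\<close>, which is never 1.\<close>

lemma free_if_generator_power:
  assumes "coprime t (2 * int n)" and S: "mset S = mset (replicate (2 * n - 1) (Y t) @ [X s])"
  shows "product_one_free G S"
proof (rule product_one_free_power_append[OF is_group _ _ _ _ S])
  fix j :: nat assume j: "0 < j" "j < 2 * n"
  show "Y t [^] j \<noteq> \<one>"
  proof
    assume "Y t [^] j = \<one>"
    then have "2 * int n dvd int j"
      using assms(1) by (simp add: Y_pow Y_eq_one coprime_dvd_mult_left_iff coprime_commute)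
    then have "2 * n dvd j" by (metis of_nat_dvd_iff of_nat_mult of_nat_numeral)
    with j show False by (auto dest: dvd_imp_le)
  qed
qed (use n_ge_2 in \<open>simp_all add: Y_pow\<close>)

text \<open>The exponents in \<open>C\<close> form a zero-sum free multiset of maximal size, so all
  are congruent to one \<open>t\<close>. Freeness for repetitions of \<open>Y t\<close> then forces
  \<open>t\<close> to be a unit modulo \<open>2 * n\<close>.\<close>

lemma free_max_length:
  assumes free: "product_one_free G S" and S: "mset S = {#X s#} + image_mset Y C"
    and size: "size C = 2 * n - 1"
  obtains t where "0 < t" "t < 2 * n" "coprime t (2 * n)"
    "mset S = mset (replicate (2 * n - 1) (Y (int t)) @ [X s])"
proof -
  have zsf: "zero_sum_free (int (2 * n)) C"
    using free S by (intro free_exponents(1)[of S "{#s#}"]) simp_all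
  obtain c C' where C: "C = add_mset c C'"
    using size n_ge_2 by (cases C) auto
  define t where "t = nat (c mod int (2 * n))"
  have t: "int t = c mod int (2 * n)" using n_ge_2 by (simp add: t_def)
  have eq: "d mod int (2 * n) = c mod int (2 * n)" if "d \<in># C" for d
  proof (cases "d \<in># C'")
    case True
    then have "{#d, c#} \<subseteq># C" using C by (simp add: insert_subset_eq_iff)
    then show ?thesis using n_ge_2 size by (intro zero_sum_free_max_cong[OF zsf]) auto
  qed (use that C in auto)
  have "Y d = Y (int t)" if "d \<in># C" for d
    using eq[OF that] t by (intro Y_cong) simp
  then have "image_mset Y C = image_mset (\<lambda>_. Y (int t)) C"
    by (rule image_mset_cong)
  then have S': "mset S = mset (replicate (2 * n - 1) (Y (int t)) @ [X s])"
    using S size by (simp add: image_mset_const_eq)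
  have pow: "\<not> 2 * n dvd j * t" if j: "0 < j" "j < 2 * n" for j
  proof
    assume "2 * n dvd j * t"
    then have "int (2 * n) dvd int j * int t" by (metis of_nat_dvd_iff of_nat_mult)
    then have "Y (sum_list (replicate j (int t))) = \<one>"
      by (simp add: Y_eq_one sum_list_replicate)
    then have "foldr (\<otimes>) (replicate j (Y (int t))) \<one> = \<one>"
      using foldr_Y[of "replicate j (int t)"] by simp
    moreover have "mset (replicate j (Y (int t))) \<subseteq># mset S"
      unfolding S' using j by (auto simp flip: count_le_replicate_mset_subset_eq)
    ultimately show False
      using free j unfolding product_one_free_iff by (metis length_greater_0_conv length_replicate)
  qed
  have t_less: "t < 2 * n" using t n_ge_2 by (simp add: t_def nat_less_iff)
  have "coprime t (2 * n)"
  proof (rule ccontr)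
    assume "\<not> coprime t (2 * n)"
    define g where "g = gcd t (2 * n)"
    with \<open>\<not> coprime t (2 * n)\<close> have "g \<noteq> 1" by (simp add: coprime_iff_gcd_eq_1)
    moreover have "g \<noteq> 0" using n_ge_2 by (simp add: g_def)
    ultimately have "1 < g" by simp
    \<comment> \<open>\<open>h\<close> is \<open>2 * n\<close> divided by the gcd; that many copies
      of \<open>Y t\<close> already have product 1, and they are fewer than
      \<open>2 * n\<close>.\<close>
    obtain h k where h: "2 * n = g * h" and k: "t = g * k"
      unfolding g_def by (metis dvdE gcd_dvd1 gcd_dvd2)
    have "0 < h" using h n_ge_2 by (cases h) auto
    moreover have "h < 2 * n" using h \<open>1 < g\<close> \<open>0 < h\<close> by simp
    moreover have "2 * n dvd h * t" using h k by simp
    ultimately show False using pow by blast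
  qed
  moreover have "0 < t" using pow[of 1] n_ge_2 by (cases t) auto
  ultimately show thesis using that t_less S' by blast
qed

lemma product_one_free_iff_large:
  assumes "3 \<le> n" "set S \<subseteq> carrier G" "length S = 2 * n"
  shows "product_one_free G S \<longleftrightarrow>
    (\<exists>t s :: nat. 1 \<le> t \<and> t \<le> 2 * n - 1 \<and> gcd t (2 * n) = 1 \<and> s \<le> 2 * n - 1 \<and>
      mset S = mset (replicate (2 * n - 1) (Y (int t)) @ [X (int s)]))"
proof
  assume free: "product_one_free G S"
  obtain B C where S: "mset S = image_mset X B + image_mset Y C"
    using exponents_exist assms(2) by blast
  have "size (mset S) = size B + size C" unfolding S by simp
  with assms(3) have size: "size B + size C = 2 * n" by simp
  have "size B = 1"
    using size_B_eq_1[OF n_ge_2 size free_exponents[OF free S]] assms(1) by blast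
  then obtain b where B: "B = {#b#}" by (metis size_1_singleton_mset)
  define s where "s = nat (b mod (2 * int n))"
  have s: "s \<le> 2 * n - 1" using n_ge_2 pos_mod_bound[of "2 * int n" b]
    by (simp add: s_def nat_le_iff of_nat_diff)
  have "int s = b mod (2 * int n)" using n_ge_2 by (simp add: s_def)
  then have Xs: "X (int s) = X b" by (intro X_cong) simp
  obtain t where "0 < t" "t < 2 * n" "coprime t (2 * n)"
      "mset S = mset (replicate (2 * n - 1) (Y (int t)) @ [X (int s)])"
    unfolding Xs using size S B by (auto intro: free_max_length[OF free, of b C])
  with s show "\<exists>t s :: nat. 1 \<le> t \<and> t \<le> 2 * n - 1 \<and> gcd t (2 * n) = 1 \<and> s \<le> 2 * n - 1 \<and>
      mset S = mset (replicate (2 * n - 1) (Y (int t)) @ [X (int s)])"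
    by (intro exI[of _ t] exI[of _ s]) (auto simp: coprime_iff_gcd_eq_1)
next
  assume "\<exists>t s :: nat. 1 \<le> t \<and> t \<le> 2 * n - 1 \<and> gcd t (2 * n) = 1 \<and> s \<le> 2 * n - 1 \<and>
      mset S = mset (replicate (2 * n - 1) (Y (int t)) @ [X (int s)])"
  then obtain t s :: nat where "gcd t (2 * n) = 1"
    and S: "mset S = mset (replicate (2 * n - 1) (Y (int t)) @ [X (int s)])" by auto
  then have "coprime (int t) (2 * int n)"
    by (metis coprime_iff_gcd_eq_1 coprime_int_iff of_nat_mult of_nat_numeral)
  then show "product_one_free G S" using S by (rule free_if_generator_power)
qed

lemma X_pow_numeral:
  "X b [^] (2 :: nat) = Y (int n)" "X b [^] (3 :: nat) = X (b - int n)"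
  by (simp_all add: numeral_2_eq_2 numeral_3_eq_3)

lemma less_4_cases: "(j :: nat) < 4 \<Longrightarrow> j = 0 \<or> j = 1 \<or> j = 2 \<or> j = 3"
  by auto

text \<open>For even \<open>n\<close> parity is an invariant: multiplying by \<open>X s\<close>
  keeps the deviation \<open>e\<close> even, since its new value is \<open>- e\<close> or
  \<open>int n - e\<close>.\<close>

lemma X_pow_parity:
  assumes "even n"
  shows "\<exists>e. even e \<and> (X s [^] (j :: nat) = Y e \<or> X s [^] j = X (s + e))"
proof (induction j)
  case 0
  show ?case by (intro exI[of _ 0]) simp
next
  case (Suc j)
  then obtain e where e: "even e" and "X s [^] j = Y e \<or> X s [^] j = X (s + e)" by blast
  then have "X s [^] Suc j = X (s + (- e)) \<or> X s [^] Suc j = Y (int n - e)" by auto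
  moreover have "even (- e)" "even (int n - e)" using e assms by simp_all
  ultimately show ?case by blast
qed

lemma Y_odd_neq_one: "odd c \<Longrightarrow> Y c \<noteq> \<one>"
  unfolding Y_eq_one by (metis dvd_mult_left)

text \<open>This covers the last two families for \<open>n = 2\<close>. A word containing
  \<open>g\<close> once evaluates to some \<open>X b\<close> or, by the parity invariant and odd
  \<open>r\<close>, to a \<open>Y\<close> with odd exponent; neither is 1.\<close>

lemma free_if_X_power:
  assumes "n = 2" "odd r" and g: "g = Y r \<or> g = X (r + s)"
    and S: "mset S = mset (replicate 3 (X s) @ [g])"
  shows "product_one_free G S"
proof (rule product_one_free_power_append[OF is_group, where a = "X s" and b = g and m = 4])
  fix j :: nat assume "0 < j" "j < 4"
  then show "X s [^] j \<noteq> \<one>"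
    using less_4_cases[of j] assms(1) by (auto simp: X_pow_numeral Y_eq_one)
next
  fix i j :: nat
  obtain e f where "even e" "X s [^] i = Y e \<or> X s [^] i = X (s + e)"
    and "even f" "X s [^] j = Y f \<or> X s [^] j = X (s + f)"
    using X_pow_parity assms(1) by (metis even_numeral)
  then show "X s [^] i \<otimes> (g \<otimes> X s [^] j) \<noteq> \<one>"
    using g \<open>odd r\<close> assms(1) by (elim disjE) (simp_all add: Y_odd_neq_one)
qed (use g S in auto)

lemma product_one_free_iff_2:
  assumes "n = 2" "set S \<subseteq> carrier G" "length S = 2 * n"
  shows "product_one_free G S \<longleftrightarrow>
    (\<exists>r\<in>{1, 3 :: nat}. \<exists>s\<in>{0, 1, 2, 3 :: nat}.
      mset S = mset [Y (int r), Y (int r), Y (int r), X (int s)] \<or>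
      mset S = mset [Y (int r), X (int s), X (int s), X (int s)] \<or>
      mset S = mset [X (int s), X (int s), X (int s), X (int (r + s))])" (is "_ \<longleftrightarrow> ?R")
proof
  assume free: "product_one_free G S"
  obtain B C where S: "mset S = image_mset X B + image_mset Y C"
    using exponents_exist assms(2) by blast
  have "size (mset S) = size B + size C" unfolding S by simp
  with assms(3) have size: "size B + size C = 2 * n" by simp
  have X_mod: "X b = X (int (nat (b mod 4)))" for b
    using assms(1) by (intro X_cong) simp
  have Y_mod: "Y b = Y (int (nat (b mod 4)))" for b
    using assms(1) by (intro Y_cong) simp
  have s4: "nat (b mod 4) \<in> {0, 1, 2, 3}" for b :: int
    using less_4_cases[of "nat (b mod 4)"] by (simp add: nat_less_iff)
  have r4: "nat (c mod 4) \<in> {1, 3}" if "odd c" for c :: int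
  proof -
    have "c mod 4 = 1 \<or> c mod 4 = 3" using that by presburger
    then show ?thesis by auto
  qed
  have X_eq: "X a = X (int (nat (b mod 4)))" if "a mod 4 = b mod 4" for a b
    using that X_mod[of a] by simp
  consider "size B = 1" | "2 \<le> size B"
    using size_B_pos[OF n_ge_2 size free_exponents[OF free S]] by fastforce
  then show ?R
  proof cases
    case 1
    then obtain b where B: "B = {#b#}" by (metis size_1_singleton_mset)
    obtain t where t: "0 < t" "t < 2 * n" "coprime t (2 * n)"
        "mset S = mset (replicate (2 * n - 1) (Y (int t)) @ [X b])"
      using size S B by (auto intro: free_max_length[OF free, of b C])
    have "odd t" using t(3) by auto
    with t(2) assms(1) have "t \<in> {1, 3}" using less_4_cases[of t] by auto
    moreover have "mset S = mset [Y (int t), Y (int t), Y (int t), X (int (nat (b mod 4)))]"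
      using t(4) assms(1) X_mod[of b] by (simp add: numeral_3_eq_3)
    ultimately show ?thesis using s4[of b] by blast
  next
    case 2
    from n_eq_2_exponents[OF n_ge_2 size free_exponents[OF free S] assms(1) 2]
    consider a b u c where "B = {#a, b, u#}" "C = {#c#}" "odd c" "a mod 4 = b mod 4" "u mod 4 = b mod 4"
      | a b u v where "B = {#a, b, u, v#}" "C = {#}" "odd (v - b)" "a mod 4 = b mod 4" "u mod 4 = b mod 4"
      by blast
    then show ?thesis
    proof cases
      case (1 a b u c)
      let ?s = "int (nat (b mod 4))" and ?r = "int (nat (c mod 4))"
      have "X a = X ?s" "X b = X ?s" "X u = X ?s" "Y c = Y ?r"
        using 1 X_eq[of a b] X_eq[of u b] X_eq[of b b] Y_mod[of c] by auto
      then have "mset S = mset [Y ?r, X ?s, X ?s, X ?s]"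
        unfolding S 1(1,2) by simp
      then show ?thesis using r4[OF 1(3)] s4[of b] by blast
    next
      case (2 a b u v)
      \<comment> \<open>\<open>?r\<close> is the offset of the exceptional exponent \<open>v\<close>
        from the common one; it is odd, hence 1 or 3.\<close>
      let ?s = "nat (b mod 4)" and ?r = "nat ((v - b) mod 4)"
      have "int (?r + ?s) mod 4 = v mod 4" by (simp add: mod_simps)
      then have "X v = X (int (?r + ?s))" using assms(1) by (intro X_cong) simp
      moreover have "X a = X (int ?s)" "X b = X (int ?s)" "X u = X (int ?s)"
        using 2 X_eq[of a b] X_eq[of u b] X_eq[of b b] by auto
      ultimately have "mset S = mset [X (int ?s), X (int ?s), X (int ?s), X (int (?r + ?s))]"
        unfolding S 2(1,2) by simp
      then show ?thesis using r4[OF 2(3)] s4[of b] by blast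
    qed
  qed
next
  assume ?R
  then obtain r s :: nat where r: "r \<in> {1, 3}" and
    cases: "mset S = mset [Y (int r), Y (int r), Y (int r), X (int s)] \<or>
      mset S = mset [Y (int r), X (int s), X (int s), X (int s)] \<or>
      mset S = mset [X (int s), X (int s), X (int s), X (int (r + s))]" by blast
  from r have odd: "odd (int r)" by auto
  from cases show "product_one_free G S"
  proof (elim disjE)
    assume "mset S = mset [Y (int r), Y (int r), Y (int r), X (int s)]"
    moreover have "coprime (int r) (2 * 2)"
      using odd unfolding coprime_mult_right_iff coprime_right_2_iff_odd by simp
    ultimately show ?thesis
      using assms(1) by (intro free_if_generator_power[of "int r" S "int s"])
        (simp_all add: numeral_3_eq_3)
  next
    assume "mset S = mset [Y (int r), X (int s), X (int s), X (int s)]"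
    then show ?thesis using assms(1) odd
      by (intro free_if_X_power[of "int r" "Y (int r)" "int s"]) (simp_all add: numeral_3_eq_3)
  next
    assume "mset S = mset [X (int s), X (int s), X (int s), X (int (r + s))]"
    then show ?thesis using assms(1) odd
      by (intro free_if_X_power[of "int r" "X (int r + int s)" "int s"]) (simp_all add: numeral_3_eq_3)
  qed
qed

end

section \<open>The presented group satisfies the exponent laws\<close>

lemma dic_y_pow:
  "dic_y n [^]\<^bsub>dicyclic n\<^esub> (k :: nat) = pres_class (dicyclic_relations n) (replicate k (GenY, True))"
proof -
  interpret group "dicyclic n" by (rule group_dicyclic)
  show ?thesis
  proof (induction k)
    case 0
    then show ?case by (simp add: dicyclic_def presented_group_def)
  next
    case (Suc k)
    then show ?case
      by (simp add: dic_y_def dicyclic_def presented_group_mult replicate_append_same)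
  qed
qed

lemma dic_y_closed [simp]: "dic_y n \<in> carrier (dicyclic n)"
  and dic_x_closed [simp]: "dic_x n \<in> carrier (dicyclic n)"
  by (simp_all add: dic_x_def dic_y_def dicyclic_def presented_group_def)

lemma dic_y_pow_2n: "dic_y n [^]\<^bsub>dicyclic n\<^esub> (2 * n) = \<one>\<^bsub>dicyclic n\<^esub>"
proof -
  have "pres_eq (dicyclic_relations n) (replicate (2 * n) (GenY, True)) []"
    by (rule pres_rel) (simp add: dicyclic_relations_def)
  then show ?thesis
    unfolding dic_y_pow by (simp add: dicyclic_def presented_group_def pres_class_eq_iff)
qed

text \<open>Reduction below \<open>2 * n\<close> makes an integer power the class of an explicit
  word of repeated \<open>GenY\<close> letters.\<close>

lemma dic_y_int_pow_mod:
  assumes "1 \<le> n"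
  shows "dic_y n [^]\<^bsub>dicyclic n\<^esub> (c :: int) =
    dic_y n [^]\<^bsub>dicyclic n\<^esub> nat (c mod (2 * int n))"
proof -
  interpret group "dicyclic n" by (rule group_dicyclic)
  let ?G = "dicyclic n" and ?m = "2 * int n"
  have "dic_y n [^]\<^bsub>?G\<^esub> ?m = dic_y n [^]\<^bsub>?G\<^esub> (2 * n)"
    by (metis int_pow_int of_nat_mult of_nat_numeral)
  then have one: "dic_y n [^]\<^bsub>?G\<^esub> ?m = \<one>\<^bsub>?G\<^esub>" by (simp add: dic_y_pow_2n)
  have "dic_y n [^]\<^bsub>?G\<^esub> c = dic_y n [^]\<^bsub>?G\<^esub> (?m * (c div ?m) + c mod ?m)" by simp
  also have "\<dots> = (dic_y n [^]\<^bsub>?G\<^esub> ?m) [^]\<^bsub>?G\<^esub> (c div ?m) \<otimes>\<^bsub>?G\<^esub> dic_y n [^]\<^bsub>?G\<^esub> (c mod ?m)"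
    by (simp only: int_pow_mult int_pow_pow dic_y_closed)
  also have "\<dots> = dic_y n [^]\<^bsub>?G\<^esub> (c mod ?m)" using one by simp
  also have "\<dots> = dic_y n [^]\<^bsub>?G\<^esub> int (nat (c mod ?m))" using assms by simp
  finally show ?thesis by (simp only: int_pow_int)
qed

text \<open>Relations alone cannot show that elements differ. The action on normal forms, started at
  \<open>(False, 0)\<close>, the code of the empty word, provides the separating invariant.\<close>

lemma pres_eq_dic_act:
  assumes "1 \<le> n" "pres_class (dicyclic_relations n) u = pres_class (dicyclic_relations n) v"
  shows "foldr (dic_act_letter n) u (False, 0) = foldr (dic_act_letter n) v (False, 0)"
  using assms dic_act_pres_eq[of n u v "(False, 0)"] by (simp add: pres_class_eq_iff)

text \<open>The product laws follow from the relations, the description of the carrier from the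
  normal form, and the nontriviality claims from the action.\<close>

lemma dicyclic_exponents:
  assumes "2 \<le> n"
  shows "dicyclic_exponents (dicyclic n) n
    (\<lambda>b. dic_x n \<otimes>\<^bsub>dicyclic n\<^esub> dic_y n [^]\<^bsub>dicyclic n\<^esub> b) (\<lambda>c. dic_y n [^]\<^bsub>dicyclic n\<^esub> c)"
proof -
  interpret group "dicyclic n" by (rule group_dicyclic)
  let ?G = "dicyclic n" and ?R = "dicyclic_relations n"
  let ?Y = "\<lambda>c :: int. dic_y n [^]\<^bsub>?G\<^esub> c"
  let ?X = "\<lambda>b. dic_x n \<otimes>\<^bsub>?G\<^esub> ?Y b"
  have one: "\<one>\<^bsub>?G\<^esub> = pres_class ?R []"
    by (simp add: dicyclic_def presented_group_def)
  have Y_class: "?Y c = pres_class ?R (replicate (nat (c mod (2 * int n))) (GenY, True))" for c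
    using assms by (simp add: dic_y_int_pow_mod dic_y_pow)
  have X_class: "?X b = pres_class ?R ((GenX, True) # replicate (nat (b mod (2 * int n))) (GenY, True))" for b
    unfolding Y_class by (simp add: dic_x_def dicyclic_def presented_group_mult)
  have xx: "dic_x n \<otimes>\<^bsub>?G\<^esub> dic_x n = ?Y (int n)"
  proof -
    have "pres_eq ?R [(GenX, True), (GenX, True)] (replicate n (GenY, True))"
      by (rule pres_rel) (simp add: dicyclic_relations_def numeral_2_eq_2)
    then show ?thesis unfolding int_pow_int dic_y_pow
      by (simp add: dic_x_def dicyclic_def presented_group_mult pres_class_eq_iff)
  qed
  have yx: "dic_y n \<otimes>\<^bsub>?G\<^esub> dic_x n = dic_x n \<otimes>\<^bsub>?G\<^esub> inv\<^bsub>?G\<^esub> dic_y n"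
  proof -
    have "pres_class ?R [(GenY, False)] \<otimes>\<^bsub>?G\<^esub> dic_y n = \<one>\<^bsub>?G\<^esub>"
      using pres_cancel[of ?R GenY False] unfolding one
      by (simp add: dic_y_def dicyclic_def presented_group_mult pres_class_eq_iff)
    then have "inv\<^bsub>?G\<^esub> dic_y n = pres_class ?R [(GenY, False)]"
      by (intro inv_equality) (simp_all add: dicyclic_def presented_group_def dic_y_def)
    moreover have "pres_eq ?R [(GenY, True), (GenX, True)] [(GenX, True), (GenY, False)]"
      by (rule pres_rel) (simp add: dicyclic_relations_def)
    ultimately show ?thesis
      by (simp add: dic_x_def dic_y_def dicyclic_def presented_group_mult pres_class_eq_iff)
  qed
  have Yx_nat: "?Y (int k) \<otimes>\<^bsub>?G\<^esub> dic_x n = dic_x n \<otimes>\<^bsub>?G\<^esub> ?Y (- int k)" for k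
  proof (induction k)
    case (Suc k)
    have "?Y (int (Suc k)) = ?Y (int k) \<otimes>\<^bsub>?G\<^esub> dic_y n"
      using int_pow_mult[of "dic_y n" "int k" 1] by (simp add: add.commute)
    then have "?Y (int (Suc k)) \<otimes>\<^bsub>?G\<^esub> dic_x n = ?Y (int k) \<otimes>\<^bsub>?G\<^esub> (dic_x n \<otimes>\<^bsub>?G\<^esub> inv\<^bsub>?G\<^esub> dic_y n)"
      by (simp add: m_assoc yx)
    also have "\<dots> = dic_x n \<otimes>\<^bsub>?G\<^esub> (?Y (- int k) \<otimes>\<^bsub>?G\<^esub> ?Y (- 1))"
      using Suc by (simp add: m_assoc[symmetric] int_pow_neg)
    also have "?Y (- int k) \<otimes>\<^bsub>?G\<^esub> ?Y (- 1) = ?Y (- int (Suc k))"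
      using int_pow_mult[of "dic_y n" "- int k" "- 1"] by (simp add: minus_add_distrib add.commute)
    finally show ?case .
  qed simp
  \<comment> \<open>Negative exponents are reached by periodicity: \<open>c\<close> and
    \<open>- c\<close> are replaced by a natural representative and its negative.\<close>
  have Yx: "?Y c \<otimes>\<^bsub>?G\<^esub> dic_x n = dic_x n \<otimes>\<^bsub>?G\<^esub> ?Y (- c)" for c
  proof -
    have "?Y c = ?Y (int (nat (c mod (2 * int n))))"
      using assms by (simp only: int_pow_int dic_y_int_pow_mod)
    moreover have "?Y (- c) = ?Y (- int (nat (c mod (2 * int n))))"
      using assms by (simp add: dic_y_int_pow_mod[of n "- c"]
        dic_y_int_pow_mod[of n "- (c mod (2 * int n))"] mod_simps)
    ultimately show ?thesis using Yx_nat[of "nat (c mod (2 * int n))"] by metis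
  qed
  show ?thesis
  proof
    fix a b c d :: int
    show "?Y c \<otimes>\<^bsub>?G\<^esub> ?Y d = ?Y (c + d)" by (simp add: int_pow_mult)
    show "?X b \<otimes>\<^bsub>?G\<^esub> ?Y c = ?X (b + c)" by (simp add: int_pow_mult m_assoc)
    have Y_X: "?Y c \<otimes>\<^bsub>?G\<^esub> ?X b = ?X (b - c)" for b c
    proof -
      have "?Y c \<otimes>\<^bsub>?G\<^esub> ?X b = dic_x n \<otimes>\<^bsub>?G\<^esub> (?Y (- c) \<otimes>\<^bsub>?G\<^esub> ?Y b)"
        using Yx[of c] by (simp add: m_assoc[symmetric])
      also have "?Y (- c) \<otimes>\<^bsub>?G\<^esub> ?Y b = ?Y (b - c)"
        by (subst int_pow_mult[symmetric]) simp_all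
      finally show ?thesis .
    qed
    then show "?Y c \<otimes>\<^bsub>?G\<^esub> ?X b = ?X (b - c)" .
    have "?X a \<otimes>\<^bsub>?G\<^esub> ?X b = dic_x n \<otimes>\<^bsub>?G\<^esub> ?X (b - a)"
      using Y_X[of a b] by (simp add: m_assoc)
    also have "\<dots> = ?Y (int n) \<otimes>\<^bsub>?G\<^esub> ?Y (b - a)" using xx by (simp add: m_assoc[symmetric])
    also have "\<dots> = ?Y (int n + b - a)"
      by (subst int_pow_mult[symmetric]) (simp_all add: algebra_simps)
    finally show "?X a \<otimes>\<^bsub>?G\<^esub> ?X b = ?Y (int n + b - a)" .
    show "?Y c = \<one>\<^bsub>?G\<^esub> \<longleftrightarrow> 2 * int n dvd c"
    proof
      assume "?Y c = \<one>\<^bsub>?G\<^esub>"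
      \<comment> \<open>The word for \<open>?Y c\<close> moves \<open>(False, 0)\<close> to
        \<open>(False, c mod (2 * int n))\<close>, whereas the empty word fixes it.\<close>
      then show "2 * int n dvd c"
        using assms unfolding Y_class one
        by (auto dest!: pres_eq_dic_act[rotated] simp: dic_act_replicate_y)
    next
      assume "2 * int n dvd c"
      then show "?Y c = \<one>\<^bsub>?G\<^esub>" unfolding Y_class one by simp
    qed
    show "?X b \<noteq> \<one>\<^bsub>?G\<^esub>"
    proof
      assume "?X b = \<one>\<^bsub>?G\<^esub>"
      \<comment> \<open>The leading letter \<open>GenX\<close> flips the first component, so the
        word for \<open>?X b\<close> cannot fix \<open>(False, 0)\<close>.\<close>
      then show False
        using assms unfolding X_class one
        by (auto dest!: pres_eq_dic_act[rotated] simp: dic_act_replicate_y)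
    qed
    show "carrier ?G = range ?X \<union> range ?Y"
    proof
      show "range ?X \<union> range ?Y \<subseteq> carrier ?G" by auto
      show "carrier ?G \<subseteq> range ?X \<union> range ?Y"
      proof
        fix g assume "g \<in> carrier ?G"
        then obtain w where w: "g = pres_class ?R w"
          by (auto simp: dicyclic_def presented_group_def)
        obtain e k where e: "e < 2" "k < 2 * n"
          and "pres_eq ?R w (replicate e (GenX, True) @ replicate k (GenY, True))"
          using dicyclic_normal_form[of n w] assms by auto
        then have g: "g = pres_class ?R (replicate e (GenX, True) @ replicate k (GenY, True))"
          using w by (simp add: pres_class_eq_iff)
        have k: "nat (int k mod (2 * int n)) = k" using e(2) by simp
        from e(1) consider "e = 0" | "e = 1" by linarith
        then have "g = ?Y (int k) \<or> g = ?X (int k)"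
          using X_class[of "int k"] Y_class[of "int k"] unfolding g k by cases simp_all
        then show "g \<in> range ?X \<union> range ?Y" by blast
      qed
    qed
  qed (use assms in auto)
qed

theorem theorem1p4:
  fixes n :: nat and S :: "dicyclic_gen word set list"
  assumes "n \<ge> 2"
    and "set S \<subseteq> carrier (dicyclic n)"
    and "length S = 2 * n"
  shows
    "(n \<ge> 3 \<longrightarrow>
       (product_one_free (dicyclic n) S \<longleftrightarrow>
        (\<exists>t s :: nat. 1 \<le> t \<and> t \<le> 2 * n - 1 \<and> gcd t (2 * n) = 1 \<and> s \<le> 2 * n - 1 \<and>
           mset S = mset (replicate (2 * n - 1) (dic_y n [^]\<^bsub>dicyclic n\<^esub> t)
                 @ [dic_x n \<otimes>\<^bsub>dicyclic n\<^esub> dic_y n [^]\<^bsub>dicyclic n\<^esub> s]))))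
   \<and> (n = 2 \<longrightarrow>
       (product_one_free (dicyclic n) S \<longleftrightarrow>
        (\<exists>r \<in> {1, 3 :: nat}. \<exists>s \<in> {0, 1, 2, 3 :: nat}.
           let y_pow = (\<lambda>k :: nat. dic_y n [^]\<^bsub>dicyclic n\<^esub> k);
               xy_pow = (\<lambda>k :: nat. dic_x n \<otimes>\<^bsub>dicyclic n\<^esub> y_pow k)
           in mset S = mset [y_pow r, y_pow r, y_pow r, xy_pow s] \<or>
              mset S = mset [y_pow r, xy_pow s, xy_pow s, xy_pow s] \<or>
              mset S = mset [xy_pow s, xy_pow s, xy_pow s, xy_pow (r + s)])))"
proof -
  interpret E: dicyclic_exponents "dicyclic n" n
    "\<lambda>b. dic_x n \<otimes>\<^bsub>dicyclic n\<^esub> dic_y n [^]\<^bsub>dicyclic n\<^esub> (b :: int)"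
    "\<lambda>c. dic_y n [^]\<^bsub>dicyclic n\<^esub> (c :: int)"
    by (rule dicyclic_exponents) fact
  show ?thesis
    unfolding Let_def
    \<comment> \<open>Unfolding \<open>int_pow_int\<close> turns the integer exponents of the locale
      into the natural exponents of the theorem.\<close>
    by (intro conjI impI E.product_one_free_iff_large[OF _ assms(2,3), unfolded int_pow_int]
        E.product_one_free_iff_2[OF _ assms(2,3), unfolded int_pow_int])
qed

end
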